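(* Let $G$ be a finite non-abelian group, let $\chi$ be the character of an irreducible complex representation of $G$ of dimension $n>1$, and let $K$, $G_0$, $\gamma$, $C_0$ and the numbers $a_{1,t}$ be as defined in the context, with $\gamma>0$. Then: (a) For every real $t>0$, $$\left(\frac{a_{1,t}/n^{t}-|K|/|G|}{(|G|-|G_0|-|K|)/|G|}\right)^{1/t}\;\le\;\frac{\gamma}{n}\;\le\;\left(\frac{a_{1,t}/n^{t}-|K|/|G|}{|C_0|/|G|}\right)^{1/t},$$ or equivalently $$\left(\left(\frac{\gamma}{n}\right)^{t}\frac{|G|-|G_0|-|K|}{|G|}+\frac{|K|}{|G|}\right)^{1/t}\;\ge\;\frac{(a_{1,t})^{1/t}}{n}\;\ge\;\left(\left(\frac{\gamma}{n}\right)^{t}\frac{|C_0|}{|G|}+\frac{|K|}{|G|}\right)^{1/t}.$$ (b) The left-most and the right-most sides of the first displayed chain of inequalities in (a) both converge to $\gamma/n$ as $t\to\infty$. (c) The left-most and the right-most sides of the second displayed chain of inequalities in (a) both converge to $1$ as $t\to\infty$, and therefore $\lim_{t\to\infty}(a_{1,t})^{1/t}=n$. (d) As functions of $t$, $\left(\frac{\gamma}{n}\right)^{t}$ and $\frac{a_{1,t}/n^{t}-|K|/|G|}{|C_0|/|G|}$ are asymptotically equal as $t\to\infty$, i.e. their ratio tends to $1$.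
   Context: $|\chi|$ denotes the function $g\mapsto|\chi(g)|$ on $G$; its maximal value is $n=\chi(1)$. $K=\{g\in G: |\chi(g)|=n\}$ is the normal subgroup of all elements of $G$ acting by scalars. $G_0=\{g\in G:\chi(g)=0\}$. $\gamma$ is the second largest value of $|\chi|$, i.e. the largest value of $|\chi|$ on $G\setminus K$; it is a standing assumption that $\gamma>0$. $C_0=\{g\in G:|\chi(g)|=\gamma\}$. For real $t>0$, $a_{1,t}=\frac{1}{|G|}\sum_{g\in G}|\chi(g)|^t$ is the coefficient of the trivial character $\chi_1$ in the expansion $|\chi|^t=a_{1,t}\chi_1+\cdots+a_{k,t}\chi_k$ of the class function $|\chi|^t$ in terms of the irreducible complex characters $\chi_1,\dots,\chi_k$ of $G$ that are trivial on $K$. *)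

theory Defs
  imports Complex_Main "HOL-Algebra.Group" "Jordan_Normal_Form.VS_Connect"
begin

definition general_linear_group :: "nat \<Rightarrow> complex mat monoid" where
  "general_linear_group n = units_of (ring_mat TYPE(complex) n ())"

definition representation ::
  "('g, 'b) monoid_scheme \<Rightarrow> nat \<Rightarrow> ('g \<Rightarrow> complex mat) \<Rightarrow> bool" where
  "representation G n \<rho> \<longleftrightarrow> \<rho> \<in> hom G (general_linear_group n)"

definition invariant_subspace ::
  "('g, 'b) monoid_scheme \<Rightarrow> nat \<Rightarrow> ('g \<Rightarrow> complex mat) \<Rightarrow> complex vec set \<Rightarrow> bool" where
  "invariant_subspace G n \<rho> W \<longleftrightarrow>
     VectorSpace.subspace class_ring W (module_vec TYPE(complex) n) \<and>
     (\<forall>g \<in> carrier G. \<forall>w \<in> W. \<rho> g *\<^sub>v w \<in> W)"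

definition irreducible_representation ::
  "('g, 'b) monoid_scheme \<Rightarrow> nat \<Rightarrow> ('g \<Rightarrow> complex mat) \<Rightarrow> bool" where
  "irreducible_representation G n \<rho> \<longleftrightarrow>
     representation G n \<rho> \<and> n > 0 \<and>
     (\<forall>W. invariant_subspace G n \<rho> W \<longrightarrow> W = {0\<^sub>v n} \<or> W = carrier_vec n)"

definition mat_trace :: "complex mat \<Rightarrow> complex" where
  "mat_trace A = (\<Sum>i<dim_row A. A $$ (i, i))"

definition rep_character :: "('g \<Rightarrow> complex mat) \<Rightarrow> 'g \<Rightarrow> complex" where
  "rep_character \<rho> g = mat_trace (\<rho> g)"

text \<open>For a character \<open>\<chi>\<close> of degree \<open>n\<close>, the maximal value of \<open>|\<chi>|\<close> is \<open>n\<close>, and it is attained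
  exactly at the group elements acting by scalars.\<close>

definition maximal_modulus_set ::
  "('g, 'b) monoid_scheme \<Rightarrow> nat \<Rightarrow> ('g \<Rightarrow> complex) \<Rightarrow> 'g set" where
  "maximal_modulus_set G n \<chi> = {g \<in> carrier G. cmod (\<chi> g) = real n}"

definition character_zeros :: "('g, 'b) monoid_scheme \<Rightarrow> ('g \<Rightarrow> complex) \<Rightarrow> 'g set" where
  "character_zeros G \<chi> = {g \<in> carrier G. \<chi> g = 0}"

text \<open>The maximum below is over a finite set, which is nonempty when \<open>\<chi>\<close> is irreducible
  of degree \<open>n > 1\<close>: otherwise all group elements would act by scalars.\<close>

definition second_modulus ::
  "('g, 'b) monoid_scheme \<Rightarrow> nat \<Rightarrow> ('g \<Rightarrow> complex) \<Rightarrow> real" where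
  "second_modulus G n \<chi> =
     Max ((\<lambda>g. cmod (\<chi> g)) ` (carrier G - maximal_modulus_set G n \<chi>))"

definition second_modulus_set ::
  "('g, 'b) monoid_scheme \<Rightarrow> nat \<Rightarrow> ('g \<Rightarrow> complex) \<Rightarrow> 'g set" where
  "second_modulus_set G n \<chi> = {g \<in> carrier G. cmod (\<chi> g) = second_modulus G n \<chi>}"

text \<open>The coefficient of the trivial character in the class function \<open>|\<chi>|^t\<close>, i.e. its inner
  product with the trivial character, for \<open>t > 0\<close>; note \<open>0 powr t = 0\<close>.\<close>

definition trivial_coeff :: "('g, 'b) monoid_scheme \<Rightarrow> ('g \<Rightarrow> complex) \<Rightarrow> real \<Rightarrow> real" where
  "trivial_coeff G \<chi> t =
     1 / real (card (carrier G)) * (\<Sum>g\<in>carrier G. cmod (\<chi> g) powr t)"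

end

theory Submission
  imports Defs "HOL-Algebra.Multiplicative_Group" "Jordan_Normal_Form.Schur_Decomposition"
begin

text \<open>
  Write \<open>q = \<gamma> / n\<close> and \<open>S = G - K - G0\<close>. Each element of \<open>K\<close> contributes \<open>1\<close> and each element of
  \<open>G0\<close> contributes \<open>0\<close> to the sum \<open>\<Sum>g\<in>G. (|\<chi> g| / n)^t = |G| \<cdot> a t / n^t\<close>, so
  \<open>a t / n^t - |K| / |G|\<close> is \<open>1 / |G|\<close> times the sum of \<open>(|\<chi> g| / n)^t\<close> over \<open>S\<close>. On \<open>S\<close> the summands
  lie in \<open>(0, q^t]\<close>, and the value \<open>q^t\<close> is taken exactly on \<open>C0\<close>; hence
  \<open>|C0| q^t \<le> \<Sum>g\<in>S. (|\<chi> g| / n)^t \<le> |S| q^t\<close>. Taking \<open>t\<close>-th roots gives the inequalities (a). The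
  limits (b) and (c) follow by squeezing, since \<open>c^(1/t)\<close> tends to \<open>1\<close> for every \<open>c > 0\<close>. For (d),
  divide by \<open>q^t\<close>: each summand outside \<open>C0\<close> then tends to \<open>0\<close>, as it is the \<open>t\<close>-th power of a
  number below \<open>1\<close>.

  Group theory enters only through \<open>0 < q < 1\<close> and \<open>C0 \<noteq> {}\<close>. These need \<open>|\<chi>| \<le> n\<close> and the
  existence of an element outside \<open>K\<close>. Both come from one fact about a complex \<open>n \<times> n\<close> matrix \<open>A\<close> of
  finite order (\<open>norm_mat_trace_finite_order_le\<close>, \<open>finite_order_maximal_trace_scalar\<close>): the trace of
  \<open>A\<close> has modulus at most \<open>n\<close>, with equality only if \<open>A\<close> is scalar. To see it, triangularise \<open>A\<close>.
  The diagonal entries are roots of unity, which gives the bound, and equality makes all of them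
  equal to some \<open>\<mu>\<close>. An upper triangular matrix with constant diagonal \<open>\<mu> \<noteq> 0\<close> and a nonzero
  entry above the diagonal has infinite order: on the first nonzero superdiagonal, the entries of the
  \<open>k\<close>-th power are \<open>k \<mu>^(k - 1)\<close> times the original ones. If every element were in \<open>K\<close>, the group
  would therefore act by scalars, and every subspace would be invariant, contradicting
  irreducibility in dimension \<open>n > 1\<close>.
\<close>

section \<open>Traces of complex matrices of finite order\<close>

lemma mat_trace_mult_comm:
  assumes "A \<in> carrier_mat n m" "B \<in> carrier_mat m n"
  shows "mat_trace (A * B) = mat_trace (B * A)"
proof -
  have "mat_trace (A * B) = (\<Sum>i<n. \<Sum>j<m. A $$ (i, j) * B $$ (j, i))"
    using assms by (auto simp: mat_trace_def scalar_prod_def atLeast0LessThan intro!: sum.cong)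
  also have "\<dots> = (\<Sum>j<m. \<Sum>i<n. B $$ (j, i) * A $$ (i, j))"
    by (subst sum.swap) (simp add: mult.commute)
  also have "\<dots> = mat_trace (B * A)"
    using assms by (auto simp: mat_trace_def scalar_prod_def atLeast0LessThan intro!: sum.cong)
  finally show ?thesis .
qed

lemma mat_trace_similar:
  assumes "A \<in> carrier_mat n n" "similar_mat_wit A B P Q"
  shows "mat_trace A = mat_trace B"
proof -
  note w = similar_mat_witD2[OF assms]
  have "mat_trace A = mat_trace (P * (B * Q))"
    using w by (simp add: assoc_mult_mat[of _ n n _ n _ n])
  also have "\<dots> = mat_trace (B * Q * P)"
    using w by (intro mat_trace_mult_comm[of _ n n]) auto
  also have "B * Q * P = B"
    using w by (simp add: assoc_mult_mat[of _ n n _ n _ n])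
  finally show ?thesis .
qed

lemma upper_triangular_pow_index:
  fixes B :: "'a :: comm_semiring_1 mat"
  assumes B: "B \<in> carrier_mat n n" and ut: "upper_triangular B"
    and "i < n" "j \<le> i"
  shows "(B ^\<^sub>m k) $$ (i, j) = (if i = j then B $$ (i, i) ^ k else 0)"
  using assms(3,4)
proof (induction k arbitrary: i j)
  case 0
  then show ?case using B by auto
next
  case (Suc k)
  have Bk: "B ^\<^sub>m k \<in> carrier_mat n n" using B by simp
  have "(B ^\<^sub>m Suc k) $$ (i, j) = (\<Sum>l\<in>{0..<n}. (B ^\<^sub>m k) $$ (i, l) * B $$ (l, j))"
    using B Bk Suc.prems by (simp add: scalar_prod_def)
  also have "\<dots> = (\<Sum>l\<in>{0..<n}. if l = i then (B ^\<^sub>m k) $$ (i, i) * B $$ (i, j) else 0)"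
  proof (intro sum.cong refl)
    fix l assume l: "l \<in> {0..<n}"
    consider "l = i" | "l < i" | "l > i" by linarith
    then show "(B ^\<^sub>m k) $$ (i, l) * B $$ (l, j)
        = (if l = i then (B ^\<^sub>m k) $$ (i, i) * B $$ (i, j) else 0)"
    proof cases
      case 2
      then show ?thesis using Suc.IH[of i l] Suc.prems by simp
    next
      case 3
      then show ?thesis using upper_triangularD[OF ut, of j l] B l Suc.prems by simp
    qed simp
  qed
  also have "\<dots> = (B ^\<^sub>m k) $$ (i, i) * B $$ (i, j)"
    using Suc.prems by simp
  also have "\<dots> = (if i = j then B $$ (i, i) ^ Suc k else 0)"
    using Suc.IH[of i i] upper_triangularD[OF ut, of j i] B Suc.prems by (simp add: mult.commute)
  finally show ?case .
qed

text \<open>This is the first-order term of \<open>(\<mu> + N)^k\<close>: if \<open>N\<close> is supported on the superdiagonals from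
  the \<open>d\<close>-th on, then all higher powers of \<open>N\<close> vanish up to and including the \<open>d\<close>-th one.\<close>

lemma constant_diagonal_pow_index:
  fixes B :: "'a :: comm_semiring_1 mat"
  assumes B: "B \<in> carrier_mat n n"
    and diag: "\<And>i. i < n \<Longrightarrow> B $$ (i, i) = \<mu>"
    and gap: "\<And>i j. i < n \<Longrightarrow> j < n \<Longrightarrow> i \<noteq> j \<Longrightarrow> j < i + d \<Longrightarrow> B $$ (i, j) = 0"
    and "i < n" "j < n" "j \<le> i + d"
  shows "(B ^\<^sub>m k) $$ (i, j) = (if i = j then \<mu> ^ k else of_nat k * \<mu> ^ (k - 1) * B $$ (i, j))"
  using assms(4-)
proof (induction k arbitrary: i j)
  case 0
  then show ?case using B by auto
next
  case (Suc k)
  have Bk: "B ^\<^sub>m k \<in> carrier_mat n n" using B by simp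
  let ?f = "\<lambda>l. (B ^\<^sub>m k) $$ (i, l) * B $$ (l, j)"
  have "(B ^\<^sub>m Suc k) $$ (i, j) = sum ?f {0..<n}"
    using B Bk Suc.prems by (simp add: scalar_prod_def)
  also have "\<dots> = sum ?f {i, j}"
  proof (rule sum.mono_neutral_right)
    show "\<forall>l\<in>{0..<n} - {i, j}. ?f l = 0"
    proof
      fix l assume l: "l \<in> {0..<n} - {i, j}"
      show "?f l = 0"
      proof (cases "l < i + d")
        case True
        then show ?thesis using Suc.IH[of i l] gap[of i l] l Suc.prems by simp
      next
        case False
        then show ?thesis using gap[of l j] l Suc.prems by simp
      qed
    qed
  qed (use Suc.prems in auto)
  also have "\<dots> = (if i = j then \<mu> ^ Suc k else of_nat (Suc k) * \<mu> ^ k * B $$ (i, j))"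
  proof (cases "i = j")
    case True
    then show ?thesis using Suc.IH[of i i] diag Suc.prems by (simp add: mult.commute)
  next
    case False
    have "of_nat k * \<mu> ^ (k - 1) * \<mu> = of_nat k * \<mu> ^ k"
      by (cases k) (simp_all add: algebra_simps)
    then have "of_nat k * \<mu> ^ (k - 1) * B $$ (i, j) * \<mu> = of_nat k * \<mu> ^ k * B $$ (i, j)"
      by (metis mult.assoc mult.commute)
    then show ?thesis
      using False Suc.IH[of i i] Suc.IH[of i j] diag Suc.prems by (simp add: algebra_simps)
  qed
  finally show ?case by simp
qed

text \<open>Superdiagonals vanish one after another: the entry of \<open>1 = B^m\<close> on the first one not yet known
  to vanish is \<open>m \<mu>^(m - 1)\<close> times that of \<open>B\<close>, and this factor is nonzero in characteristic \<open>0\<close>.\<close>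

lemma constant_diagonal_finite_order_scalar:
  fixes B :: "'a :: field_char_0 mat"
  assumes B: "B \<in> carrier_mat n n" and ut: "upper_triangular B"
    and diag: "\<And>i. i < n \<Longrightarrow> B $$ (i, i) = \<mu>" and "\<mu> \<noteq> 0"
    and m: "m > 0" "B ^\<^sub>m m = 1\<^sub>m n"
  shows "B = \<mu> \<cdot>\<^sub>m 1\<^sub>m n"
proof -
  have gap: "i < n \<Longrightarrow> j < n \<Longrightarrow> i \<noteq> j \<Longrightarrow> j < i + d \<Longrightarrow> B $$ (i, j) = 0" for i j d
  proof (induction d arbitrary: i j)
    case 0
    then show ?case using upper_triangularD[OF ut] B by auto
  next
    case (Suc d)
    have "of_nat m * \<mu> ^ (m - 1) * B $$ (i, j) = (B ^\<^sub>m m) $$ (i, j)"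
      using constant_diagonal_pow_index[where d = d, OF B diag Suc.IH, of i j m] Suc.prems by simp
    also have "\<dots> = 0" using m Suc.prems by simp
    finally show ?case using \<open>\<mu> \<noteq> 0\<close> m by simp
  qed
  show ?thesis
    using B diag gap[of _ _ n] by (intro eq_matI) auto
qed

text \<open>Equality case of the triangle inequality. Rotating by the phase \<open>u\<close> of the sum turns it into a
  statement about real parts: numbers at most \<open>1\<close> that add up to \<open>|I|\<close> are all equal to \<open>1\<close>.\<close>

lemma norm_sum_unit_eq_card_imp_constant:
  fixes z :: "'i \<Rightarrow> complex"
  assumes fin: "finite I" and unit: "\<And>i. i \<in> I \<Longrightarrow> cmod (z i) = 1"
    and eq: "cmod (sum z I) = real (card I)"
  shows "\<exists>u. cmod u = 1 \<and> (\<forall>i\<in>I. z i = u)"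
proof (cases "I = {}")
  case True
  then show ?thesis by (intro exI[of _ 1]) auto
next
  case False
  then have c: "real (card I) > 0" using fin by (simp add: card_gt_0_iff)
  define u where "u = sum z I / of_nat (card I)"
  have u: "cmod u = 1" using eq c by (simp add: u_def norm_divide)
  then have uu: "u * cnj u = 1" by (metis complex_norm_square of_real_1 one_power2)
  have sum_eq: "sum z I = of_nat (card I) * u" using c by (simp add: u_def)
  have "(\<Sum>i\<in>I. z i * cnj u) = of_nat (card I) * (u * cnj u)"
    by (simp add: sum_distrib_right[symmetric] sum_eq mult.assoc)
  then have "(\<Sum>i\<in>I. Re (z i * cnj u)) = real (card I)"
    unfolding uu by (metis Re_sum mult.right_neutral complex_Re_of_nat)
  then have "(\<Sum>i\<in>I. 1 - Re (z i * cnj u)) = 0" by (simp add: sum_subtractf)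
  moreover have le: "Re (z i * cnj u) \<le> 1" if "i \<in> I" for i
    using complex_Re_le_cmod[of "z i * cnj u"] unit[OF that] u by (simp add: norm_mult)
  ultimately have re: "Re (z i * cnj u) = 1" if "i \<in> I" for i
    using that fin by (subst (asm) sum_nonneg_eq_0_iff) auto
  have "z i = u" if i: "i \<in> I" for i
  proof -
    have n1: "cmod (z i * cnj u) = 1" using unit[OF i] u by (simp add: norm_mult)
    have "Im (z i * cnj u) = 0"
      using cmod_power2[of "z i * cnj u"] unfolding n1 re[OF i] by simp
    then have "z i * cnj u = 1" using re[OF i] by (simp add: complex_eq_iff)
    then show ?thesis using uu by (metis mult.assoc mult.commute mult.right_neutral)
  qed
  then show ?thesis using u by blast
qed

text \<open>Conjugation preserves both the trace and the relation \<open>A^m = 1\<close>, and the latter, read off on the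
  diagonal of a triangular matrix, says that the diagonal entries are roots of unity.\<close>

lemma finite_order_triangularisation:
  fixes A :: "complex mat"
  assumes A: "A \<in> carrier_mat n n" and m: "m > 0" "A ^\<^sub>m m = 1\<^sub>m n"
  obtains B P Q where "similar_mat_wit A B P Q" "B \<in> carrier_mat n n" "upper_triangular B"
    "B ^\<^sub>m m = 1\<^sub>m n" "\<And>i. i < n \<Longrightarrow> cmod (B $$ (i, i)) = 1"
    "mat_trace A = (\<Sum>i<n. B $$ (i, i))"
proof -
  obtain es where "char_poly A = (\<Prod>a\<leftarrow>es. [:- a, 1:])"
    using char_poly_factorized[OF A] by blast
  from schur_decomposition_exists[OF A this] obtain B P Q
    where B: "B \<in> carrier_mat n n" and ut: "upper_triangular B" and w: "similar_mat_wit A B P Q"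
    unfolding similar_mat_def by blast
  note PQ = similar_mat_witD2[OF A w]
  have "B ^\<^sub>m m = Q * A ^\<^sub>m m * P"
    by (rule similar_mat_wit_pow_id[OF similar_mat_wit_sym[OF w]])
  then have Bm: "B ^\<^sub>m m = 1\<^sub>m n" using PQ m by simp
  have "cmod (B $$ (i, i)) = 1" if "i < n" for i
  proof -
    have "B $$ (i, i) ^ m = 1"
      using upper_triangular_pow_index[OF B ut that order.refl, of m] Bm that by simp
    then have "cmod (B $$ (i, i)) ^ m = 1" by (metis norm_power norm_one)
    then show ?thesis
      using power_eq_imp_eq_base[of "cmod (B $$ (i, i))" m 1] m(1) by simp
  qed
  moreover have "mat_trace A = (\<Sum>i<n. B $$ (i, i))"
    using mat_trace_similar[OF A w] B by (simp add: mat_trace_def)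
  ultimately show ?thesis using that w B ut Bm by blast
qed

lemma norm_mat_trace_finite_order_le:
  assumes "A \<in> carrier_mat n n" "m > 0" "A ^\<^sub>m m = 1\<^sub>m n"
  shows "cmod (mat_trace A) \<le> real n"
proof -
  obtain B where u: "\<And>i. i < n \<Longrightarrow> cmod (B $$ (i, i)) = 1"
    and tr: "mat_trace A = (\<Sum>i<n. B $$ (i, i))"
    using finite_order_triangularisation[OF assms] by metis
  have "cmod (mat_trace A) \<le> (\<Sum>i<n. cmod (B $$ (i, i)))" unfolding tr by (rule norm_sum)
  then show ?thesis using u by simp
qed

lemma finite_order_maximal_trace_scalar:
  assumes A: "A \<in> carrier_mat n n" and m: "m > 0" "A ^\<^sub>m m = 1\<^sub>m n"
    and tr: "cmod (mat_trace A) = real n"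
  shows "\<exists>\<mu>. A = \<mu> \<cdot>\<^sub>m 1\<^sub>m n"
proof -
  obtain B P Q where w: "similar_mat_wit A B P Q" and B: "B \<in> carrier_mat n n"
    and ut: "upper_triangular B" and Bm: "B ^\<^sub>m m = 1\<^sub>m n"
    and u: "\<And>i. i < n \<Longrightarrow> cmod (B $$ (i, i)) = 1"
    and trB: "mat_trace A = (\<Sum>i<n. B $$ (i, i))"
    by (rule finite_order_triangularisation[OF A m]) blast
  obtain \<mu> where \<mu>: "cmod \<mu> = 1" "\<And>i. i < n \<Longrightarrow> B $$ (i, i) = \<mu>"
    using norm_sum_unit_eq_card_imp_constant[of "{..<n}" "\<lambda>i. B $$ (i, i)"] u tr trB by auto
  have "B = \<mu> \<cdot>\<^sub>m 1\<^sub>m n"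
    using constant_diagonal_finite_order_scalar[OF B ut \<mu>(2) _ m(1) Bm] \<mu>(1) by force
  moreover note PQ = similar_mat_witD2[OF A w]
  ultimately have "A = \<mu> \<cdot>\<^sub>m 1\<^sub>m n"
    by (simp add: mult_smult_distrib[of _ n n _ n] mult_smult_assoc_mat[of _ n n _ n])
  then show ?thesis ..
qed

section \<open>The modulus of an irreducible character\<close>

lemma representation_carrier:
  assumes "representation G n \<rho>" "g \<in> carrier G"
  shows "\<rho> g \<in> carrier_mat n n"
  using assms
  by (auto simp: representation_def general_linear_group_def hom_def units_of_def Units_def
      ring_mat_simps)

lemma representation_mult:
  assumes "representation G n \<rho>" "g \<in> carrier G" "h \<in> carrier G"
  shows "\<rho> (g \<otimes>\<^bsub>G\<^esub> h) = \<rho> g * \<rho> h"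
  using assms
  by (auto simp: representation_def general_linear_group_def hom_def units_of_def ring_mat_simps)

lemma representation_one:
  assumes G: "group G" and rep: "representation G n \<rho>"
  shows "\<rho> \<one>\<^bsub>G\<^esub> = 1\<^sub>m n"
proof -
  interpret R: semiring "ring_mat TYPE(complex) n ()" by (rule semiring_mat)
  have "group (general_linear_group n)"
    unfolding general_linear_group_def by (rule R.units_group)
  then have "\<rho> \<one>\<^bsub>G\<^esub> = \<one>\<^bsub>general_linear_group n\<^esub>"
    using hom_one[of \<rho> G "general_linear_group n"] rep G by (simp add: representation_def)
  then show ?thesis by (simp add: general_linear_group_def units_of_def ring_mat_simps)
qed

lemma representation_pow:
  assumes G: "group G" and rep: "representation G n \<rho>" and g: "g \<in> carrier G"
  shows "\<rho> (g [^]\<^bsub>G\<^esub> (k::nat)) = \<rho> g ^\<^sub>m k"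
proof -
  interpret group G by (rule G)
  show ?thesis
  proof (induction k)
    case 0
    then show ?case using representation_one[OF G rep] representation_carrier[OF rep g] by simp
  next
    case (Suc k)
    then show ?case using representation_mult[OF rep _ g] g by simp
  qed
qed

lemma representation_finite_order:
  assumes G: "group G" "finite (carrier G)" and rep: "representation G n \<rho>"
    and g: "g \<in> carrier G"
  shows "\<rho> g ^\<^sub>m Coset.order G = 1\<^sub>m n" "Coset.order G > 0"
proof -
  interpret group G by (rule G)
  show "\<rho> g ^\<^sub>m Coset.order G = 1\<^sub>m n"
    using representation_pow[OF G(1) rep g] pow_order_eq_1[OF g] representation_one[OF G(1) rep]
    by metis
  show "Coset.order G > 0" using G(2) by (simp add: order_gt_0_iff_finite)
qed

lemma norm_rep_character_le:
  assumes "group G" "finite (carrier G)" "representation G n \<rho>" "g \<in> carrier G"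
  shows "cmod (rep_character \<rho> g) \<le> real n"
  unfolding rep_character_def
  using norm_mat_trace_finite_order_le representation_carrier representation_finite_order assms
  by metis

lemma rep_character_one:
  assumes "group G" "representation G n \<rho>"
  shows "rep_character \<rho> \<one>\<^bsub>G\<^esub> = of_nat n"
  by (simp add: rep_character_def representation_one[OF assms] mat_trace_def)

text \<open>Scalars preserve every subspace; the coordinate hyperplane \<open>v $ 0 = 0\<close> is a proper one, and it is
  nonzero because \<open>n > 1\<close>.\<close>

lemma scalar_action_not_irreducible:
  assumes scalar: "\<And>g. g \<in> carrier G \<Longrightarrow> \<exists>\<mu>. \<rho> g = \<mu> \<cdot>\<^sub>m 1\<^sub>m n" and n: "n > 1"
  shows "\<not> irreducible_representation G n \<rho>"
proof
  assume irr: "irreducible_representation G n \<rho>"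
  define W :: "complex vec set" where "W = {v \<in> carrier_vec n. v $ 0 = 0}"
  have "submodule class_ring W (module_vec TYPE(complex) n)"
    using n by (intro submodule.intro vec_module) (auto simp: W_def module_vec_simps)
  then have "VectorSpace.subspace class_ring W (module_vec TYPE(complex) n)"
    by (intro VectorSpace.subspace.intro vec_vs)
  moreover have "\<rho> g *\<^sub>v w \<in> W" if g: "g \<in> carrier G" and w: "w \<in> W" for g w
  proof -
    obtain \<mu> where \<mu>: "\<rho> g = \<mu> \<cdot>\<^sub>m 1\<^sub>m n" using scalar[OF g] by blast
    have "\<rho> g *\<^sub>v w = \<mu> \<cdot>\<^sub>v w"
      using w unfolding \<mu> W_def by (intro eq_vecI) auto
    then show ?thesis using w n by (auto simp: W_def)
  qed
  ultimately have "W = {0\<^sub>v n} \<or> W = carrier_vec n"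
    using irr by (auto simp: irreducible_representation_def invariant_subspace_def)
  moreover have "unit_vec n 1 \<in> W" "(unit_vec n 1 :: complex vec) \<noteq> 0\<^sub>v n"
    using n by (auto simp: W_def dest!: arg_cong[where f = "\<lambda>v. v $ 1"])
  moreover have "unit_vec n 0 \<in> carrier_vec n - W"
    using n by (auto simp: W_def)
  ultimately show False by blast
qed

text \<open>This makes the maximum that defines the second largest modulus range over a nonempty set.\<close>

lemma maximal_modulus_set_proper:
  assumes G: "group G" "finite (carrier G)" and irr: "irreducible_representation G n \<rho>"
    and n: "n > 1"
  shows "carrier G - maximal_modulus_set G n (rep_character \<rho>) \<noteq> {}"
proof
  assume "carrier G - maximal_modulus_set G n (rep_character \<rho>) = {}"
  then have max: "cmod (mat_trace (\<rho> g)) = real n" if "g \<in> carrier G" for g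
    using that by (auto simp: maximal_modulus_set_def rep_character_def)
  have rep: "representation G n \<rho>" using irr by (simp add: irreducible_representation_def)
  have "\<exists>\<mu>. \<rho> g = \<mu> \<cdot>\<^sub>m 1\<^sub>m n" if "g \<in> carrier G" for g
    using finite_order_maximal_trace_scalar representation_carrier[OF rep that]
      representation_finite_order[OF G rep that] max[OF that] by blast
  then show False using scalar_action_not_irreducible[OF _ n] irr by blast
qed

section \<open>Power sums and their asymptotics\<close>

lemma sum_powr_between:
  fixes f :: "'a \<Rightarrow> real"
  assumes fin: "finite S" and f: "\<And>x. x \<in> S \<Longrightarrow> 0 \<le> f x \<and> f x \<le> q" and t: "t \<ge> 0"
  shows "real (card {x \<in> S. f x = q}) * q powr t \<le> (\<Sum>x\<in>S. f x powr t)"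
    and "(\<Sum>x\<in>S. f x powr t) \<le> real (card S) * q powr t"
proof -
  have "real (card {x \<in> S. f x = q}) * q powr t = (\<Sum>x\<in>{x \<in> S. f x = q}. f x powr t)"
    by simp
  also have "\<dots> \<le> (\<Sum>x\<in>S. f x powr t)"
    using fin by (intro sum_mono2) auto
  finally show "real (card {x \<in> S. f x = q}) * q powr t \<le> (\<Sum>x\<in>S. f x powr t)" .
  have "(\<Sum>x\<in>S. f x powr t) \<le> (\<Sum>x\<in>S. q powr t)"
    using f t by (intro sum_mono powr_mono2) auto
  then show "(\<Sum>x\<in>S. f x powr t) \<le> real (card S) * q powr t" by simp
qed

lemma powr_at_top_tendsto_0:
  fixes r :: real
  assumes "0 \<le> r" "r < 1"
  shows "((\<lambda>t. r powr t) \<longlongrightarrow> 0) at_top"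
proof (cases "r = 0")
  case False
  then have "ln r < 0" using assms by simp
  then have "filterlim (\<lambda>t. ln r * t) at_bot at_top"
    using filterlim_tendsto_neg_mult_at_bot[OF tendsto_const _ filterlim_ident] by blast
  from filterlim_compose[OF exp_at_bot this] show ?thesis
    using False by (simp add: powr_def mult.commute)
qed simp

lemma powr_inverse_tendsto_1:
  fixes c :: real
  assumes "c > 0"
  shows "((\<lambda>t. c powr (1 / t)) \<longlongrightarrow> 1) at_top"
proof -
  have "((\<lambda>t::real. 1 / t) \<longlongrightarrow> 0) at_top"
    by (rule tendsto_divide_0[OF tendsto_const filterlim_at_top_imp_at_infinity[OF filterlim_ident]])
  from tendsto_powr[OF tendsto_const[of c] this] show ?thesis using assms by simp
qed

text \<open>After division by \<open>q^t\<close>, a summand equals \<open>1\<close> if \<open>f x = q\<close> and otherwise decays geometrically.\<close>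

lemma sum_powr_over_max_tendsto:
  fixes f :: "'a \<Rightarrow> real"
  assumes f: "\<And>x. x \<in> S \<Longrightarrow> 0 \<le> f x \<and> f x \<le> q" and fin: "finite S" and q: "q > 0"
  shows "((\<lambda>t. (\<Sum>x\<in>S. f x powr t) / q powr t) \<longlongrightarrow> real (card {x \<in> S. f x = q})) at_top"
proof -
  have "((\<lambda>t. f x powr t / q powr t) \<longlongrightarrow> (if f x = q then 1 else 0)) at_top" if "x \<in> S" for x
  proof (cases "f x = q")
    case False
    have "((\<lambda>t. (f x / q) powr t) \<longlongrightarrow> 0) at_top"
      using f[OF that] False q by (intro powr_at_top_tendsto_0) auto
    then show ?thesis using False f[OF that] q by (simp add: powr_divide)
  qed (use q in simp)
  then have "((\<lambda>t. \<Sum>x\<in>S. f x powr t / q powr t) \<longlongrightarrow> (\<Sum>x\<in>S. if f x = q then 1 else 0)) at_top"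
    by (rule tendsto_sum)
  moreover have "(\<Sum>x\<in>S. if f x = q then 1 else 0) = real (card {x \<in> S. f x = q})"
    using fin by (simp add: sum.If_cases Int_def)
  ultimately show ?thesis by (simp add: sum_divide_distrib)
qed

lemma powr_inverse_cancel:
  fixes q t :: real
  assumes "q \<ge> 0" "t > 0"
  shows "(q powr t) powr (1 / t) = q"
  using assms by (simp add: powr_powr)

text \<open>The \<open>t\<close>-th root sees only the exponential rate: \<open>F t / (c q^t)\<close> stays between the constants
  \<open>l / c\<close> and \<open>u / c\<close>, whose \<open>t\<close>-th roots tend to \<open>1\<close>.\<close>

lemma root_of_exponential_growth_tendsto:
  fixes F :: "real \<Rightarrow> real"
  assumes pos: "q > 0" "l > 0" "u > 0" "c > 0"
    and F: "\<And>t. t > 0 \<Longrightarrow> l * q powr t \<le> F t \<and> F t \<le> u * q powr t"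
  shows "((\<lambda>t. (F t / c) powr (1 / t)) \<longlongrightarrow> q) at_top"
proof (rule tendsto_sandwich)
  have root: "(k / c * q powr t) powr (1 / t) = (k / c) powr (1 / t) * q"
    if "t > 0" "k > 0" for t k
    using powr_mult[of "k / c" "q powr t" "1 / t"] that pos by (simp add: powr_inverse_cancel)
  have gt: "\<forall>\<^sub>F t in at_top. t > (0::real)" by (rule eventually_gt_at_top)
  show "\<forall>\<^sub>F t in at_top. (l / c) powr (1 / t) * q \<le> (F t / c) powr (1 / t)"
    using gt
  proof eventually_elim
    case (elim t)
    have "(l / c * q powr t) powr (1 / t) \<le> (F t / c) powr (1 / t)"
      using F[OF elim] pos elim by (intro powr_mono2) (auto simp: divide_right_mono)
    then show ?case using root[OF elim pos(2)] by simp
  qed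
  show "\<forall>\<^sub>F t in at_top. (F t / c) powr (1 / t) \<le> (u / c) powr (1 / t) * q"
    using gt
  proof eventually_elim
    case (elim t)
    have "0 \<le> l * q powr t" using pos by simp
    then have "0 \<le> F t" using F[OF elim] by linarith
    then have "(F t / c) powr (1 / t) \<le> (u / c * q powr t) powr (1 / t)"
      using F[OF elim] pos elim by (intro powr_mono2) (auto simp: divide_right_mono)
    then show ?case using root[OF elim pos(3)] by simp
  qed
  show "((\<lambda>t. (l / c) powr (1 / t) * q) \<longlongrightarrow> q) at_top"
    using tendsto_mult_right[OF powr_inverse_tendsto_1[of "l / c"], of q] pos by simp
  show "((\<lambda>t. (u / c) powr (1 / t) * q) \<longlongrightarrow> q) at_top"
    using tendsto_mult_right[OF powr_inverse_tendsto_1[of "u / c"], of q] pos by simp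
qed

text \<open>The base tends to \<open>\<kappa>\<close> and the exponent to \<open>0\<close>; positivity of \<open>\<kappa>\<close> excludes the indeterminate
  form \<open>0^0\<close>.\<close>

lemma root_of_decaying_plus_constant_tendsto_1:
  fixes q c \<kappa> :: real
  assumes "0 \<le> q" "q < 1" "\<kappa> > 0"
  shows "((\<lambda>t. (q powr t * c + \<kappa>) powr (1 / t)) \<longlongrightarrow> 1) at_top"
proof -
  have "((\<lambda>t::real. 1 / t) \<longlongrightarrow> 0) at_top"
    by (rule tendsto_divide_0[OF tendsto_const filterlim_at_top_imp_at_infinity[OF filterlim_ident]])
  moreover have "((\<lambda>t. q powr t * c + \<kappa>) \<longlongrightarrow> 0 * c + \<kappa>) at_top"
    using assms by (intro tendsto_intros powr_at_top_tendsto_0)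
  ultimately show ?thesis
    using tendsto_powr[of "\<lambda>t. q powr t * c + \<kappa>" "0 * c + \<kappa>" at_top "\<lambda>t. 1 / t" 0] assms by simp
qed

section \<open>Normalised moments of an irreducible character\<close>

theorem theorem1p1:
  fixes G :: "('g, 'b) monoid_scheme"
    and n :: nat
    and \<rho> :: "'g \<Rightarrow> complex mat"
    and \<chi> :: "'g \<Rightarrow> complex"
    and K G0 C0 :: "'g set"
    and \<gamma> :: real
    and a :: "real \<Rightarrow> real"
    and cG cK cG0 cC0 :: real
  assumes G: "group G" "finite (carrier G)" "\<not> comm_group G"
    and \<rho>: "irreducible_representation G n \<rho>"
    and n: "n > 1"
  defines "\<chi> \<equiv> rep_character \<rho>"
  defines "K \<equiv> maximal_modulus_set G n \<chi>"
    and "G0 \<equiv> character_zeros G \<chi>"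
    and "\<gamma> \<equiv> second_modulus G n \<chi>"
    and "C0 \<equiv> second_modulus_set G n \<chi>"
    and "a \<equiv> trivial_coeff G \<chi>"
  defines "cG \<equiv> real (card (carrier G))"
    and "cK \<equiv> real (card K)"
    and "cG0 \<equiv> real (card G0)"
    and "cC0 \<equiv> real (card C0)"
  assumes \<gamma>: "\<gamma> > 0"
  shows
    "((\<forall>t>0.
        ((a t / real n powr t - cK / cG) / ((cG - cG0 - cK) / cG)) powr (1 / t) \<le> \<gamma> / real n \<and>
        \<gamma> / real n \<le> ((a t / real n powr t - cK / cG) / (cC0 / cG)) powr (1 / t)) \<and>
     (\<forall>t>0.
        ((\<gamma> / real n) powr t * ((cG - cG0 - cK) / cG) + cK / cG) powr (1 / t)
          \<ge> a t powr (1 / t) / real n \<and>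
        a t powr (1 / t) / real n
          \<ge> ((\<gamma> / real n) powr t * (cC0 / cG) + cK / cG) powr (1 / t))) \<and>
    (((\<lambda>t. ((a t / real n powr t - cK / cG) / ((cG - cG0 - cK) / cG)) powr (1 / t))
        \<longlongrightarrow> \<gamma> / real n) at_top \<and>
     ((\<lambda>t. ((a t / real n powr t - cK / cG) / (cC0 / cG)) powr (1 / t))
        \<longlongrightarrow> \<gamma> / real n) at_top) \<and>
    (((\<lambda>t. ((\<gamma> / real n) powr t * ((cG - cG0 - cK) / cG) + cK / cG) powr (1 / t))
        \<longlongrightarrow> 1) at_top \<and>
     ((\<lambda>t. ((\<gamma> / real n) powr t * (cC0 / cG) + cK / cG) powr (1 / t)) \<longlongrightarrow> 1) at_top \<and>
     ((\<lambda>t. a t powr (1 / t)) \<longlongrightarrow> real n) at_top) \<and>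
    ((\<lambda>t. (\<gamma> / real n) powr t / ((a t / real n powr t - cK / cG) / (cC0 / cG)))
        \<longlongrightarrow> 1) at_top"
proof -
  interpret group G by (rule G(1))
  define q where "q = \<gamma> / real n"
  define S where "S = carrier G - K - G0"
  define f where "f = (\<lambda>g. cmod (\<chi> g) / real n)"
  define \<kappa> where "\<kappa> = cK / cG"
  define s where "s = (cG - cG0 - cK) / cG"
  define c where "c = cC0 / cG"
  define F where "F t = a t / real n powr t - \<kappa>" for t

  have rep: "representation G n \<rho>" using \<rho> by (simp add: irreducible_representation_def)
  have n0: "real n > 0" using n by simp
  have K_sub: "K \<subseteq> carrier G" by (auto simp: K_def maximal_modulus_set_def)
  have G0_sub: "G0 \<subseteq> carrier G" by (auto simp: G0_def character_zeros_def)
  have disj: "K \<inter> G0 = {}"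
    using n by (auto simp: K_def G0_def maximal_modulus_set_def character_zeros_def)
  have fin: "finite K" "finite G0" "finite S"
    using G(2) K_sub G0_sub by (auto simp: S_def intro: finite_subset)
  have one_K: "\<one>\<^bsub>G\<^esub> \<in> K"
    using rep_character_one[OF G(1) rep] by (simp add: K_def \<chi>_def maximal_modulus_set_def)

  let ?M = "(\<lambda>g. cmod (\<chi> g)) ` (carrier G - K)"
  have M: "finite ?M" "?M \<noteq> {}"
    using G(2) maximal_modulus_set_proper[OF G(1,2) \<rho> n] by (auto simp: K_def \<chi>_def)
  have \<gamma>_eq: "\<gamma> = Max ?M" by (simp add: \<gamma>_def second_modulus_def K_def)
  have le_\<gamma>: "cmod (\<chi> g) \<le> \<gamma>" if "g \<in> S" for g
    using that M unfolding \<gamma>_eq S_def by (intro Max_ge) auto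
  have "\<gamma> \<in> ?M" unfolding \<gamma>_eq by (rule Max_in[OF M])
  then obtain g0 where g0: "g0 \<in> carrier G" "g0 \<notin> K" "\<gamma> = cmod (\<chi> g0)" by auto
  have "\<gamma> < real n"
    using norm_rep_character_le[OF G(1,2) rep g0(1)] g0
    by (auto simp: K_def \<chi>_def maximal_modulus_set_def)
  then have q: "0 < q" "q < 1" using \<gamma> n0 by (auto simp: q_def)
  \<comment> \<open>The standing assumption \<open>\<gamma> > 0\<close> keeps \<open>C0\<close> clear of \<open>G0\<close>; \<open>\<gamma> < n\<close> keeps it clear of \<open>K\<close>.\<close>
  have C0_eq: "C0 = {g \<in> S. f g = q}"
    using \<open>\<gamma> < real n\<close> \<gamma> n0
    by (auto simp: C0_def second_modulus_set_def \<gamma>_def[symmetric] S_def K_def G0_def f_def q_def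
        maximal_modulus_set_def character_zeros_def)
  have g0_C0: "g0 \<in> C0"
    using g0 by (simp add: C0_def second_modulus_set_def \<gamma>_def[symmetric])
  have f: "0 \<le> f g \<and> f g \<le> q" if "g \<in> S" for g
    using le_\<gamma>[OF that] n0 by (auto simp: f_def q_def divide_right_mono)

  have cG: "cG > 0" using G(2) by (auto simp: cG_def card_gt_0_iff)
  have cK: "cK > 0" using fin one_K by (auto simp: cK_def card_gt_0_iff)
  have cC0: "cC0 > 0" using fin g0_C0 by (auto simp: cC0_def C0_eq card_gt_0_iff)
  have carrier_split: "carrier G = S \<union> (K \<union> G0)" "S \<inter> (K \<union> G0) = {}"
    using K_sub G0_sub by (auto simp: S_def)
  have "card (carrier G) = card S + (card K + card G0)"
    using carrier_split fin disj by (simp add: card_Un_disjoint)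
  then have card_S: "cG - cG0 - cK = real (card S)"
    by (simp add: cG_def cG0_def cK_def)
  have cS: "real (card S) > 0" using fin g0_C0 by (auto simp: C0_eq card_gt_0_iff)
  have pos: "\<kappa> > 0" "s > 0" "c > 0"
    using cG cK cC0 cS by (simp_all add: \<kappa>_def s_def c_def card_S)

  \<comment> \<open>\<open>K\<close> contributes exactly the subtracted constant \<open>\<kappa>\<close>, which leaves the power sum over \<open>S\<close>.\<close>
  have F_eq: "F t = (\<Sum>g\<in>S. f g powr t) / cG" for t
  proof -
    have "a t / real n powr t = (\<Sum>g\<in>carrier G. f g powr t) / cG"
      by (simp add: a_def trivial_coeff_def cG_def f_def powr_divide sum_divide_distrib field_simps)
    also have "(\<Sum>g\<in>carrier G. f g powr t)
        = (\<Sum>g\<in>S. f g powr t) + ((\<Sum>g\<in>K. f g powr t) + (\<Sum>g\<in>G0. f g powr t))"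
      using carrier_split fin disj by (simp add: sum.union_disjoint)
    also have "(\<Sum>g\<in>K. f g powr t) = cK"
      using n0 by (simp add: K_def maximal_modulus_set_def f_def cK_def)
    also have "(\<Sum>g\<in>G0. f g powr t) = 0"
      by (intro sum.neutral) (auto simp: G0_def character_zeros_def f_def)
    finally show ?thesis by (simp add: F_def \<kappa>_def add_divide_distrib)
  qed
  have F: "c * q powr t \<le> F t" "F t \<le> s * q powr t" if "t > 0" for t
    using sum_powr_between[OF fin(3) f, where t = t] that cG
    by (simp_all add: F_eq s_def c_def card_S cC0_def C0_eq divide_right_mono)
  have F0: "F t \<ge> 0" for t
    unfolding F_eq using cG by (intro divide_nonneg_pos sum_nonneg) auto
  have a_root: "a t powr (1 / t) / real n = (F t + \<kappa>) powr (1 / t)" if t: "t > 0" for t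
  proof -
    have "a t = (F t + \<kappa>) * real n powr t" using n0 by (simp add: F_def)
    then have "a t powr (1 / t) = (F t + \<kappa>) powr (1 / t) * real n"
      using F0[of t] pos t by (simp add: powr_mult powr_inverse_cancel)
    then show ?thesis using n0 by simp
  qed

  have a1: "(F t / s) powr (1 / t) \<le> q" "q \<le> (F t / c) powr (1 / t)" if t: "t > 0" for t
  proof -
    have "(F t / s) powr (1 / t) \<le> (q powr t) powr (1 / t)"
      using F[OF t] F0[of t] pos t by (intro powr_mono2) (auto simp: field_simps)
    then show "(F t / s) powr (1 / t) \<le> q" using q t by (simp add: powr_inverse_cancel)
    have "(q powr t) powr (1 / t) \<le> (F t / c) powr (1 / t)"
      using F[OF t] pos t by (intro powr_mono2) (auto simp: field_simps)
    then show "q \<le> (F t / c) powr (1 / t)" using q t by (simp add: powr_inverse_cancel)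
  qed
  have a2: "a t powr (1 / t) / real n \<le> (q powr t * s + \<kappa>) powr (1 / t)"
    "(q powr t * c + \<kappa>) powr (1 / t) \<le> a t powr (1 / t) / real n" if t: "t > 0" for t
    unfolding a_root[OF t]
    using F[OF t] F0[of t] pos t by (auto intro!: powr_mono2 simp: mult.commute)

  have b: "((\<lambda>t. (F t / k) powr (1 / t)) \<longlongrightarrow> q) at_top" if "k > 0" for k
    using root_of_exponential_growth_tendsto[OF q(1) pos(3,2) that] F by blast

  have c1: "((\<lambda>t. (q powr t * k + \<kappa>) powr (1 / t)) \<longlongrightarrow> 1) at_top" for k
    using root_of_decaying_plus_constant_tendsto_1 q pos by simp
  have gt: "\<forall>\<^sub>F t in at_top. t > (0::real)" by (rule eventually_gt_at_top)
  have "((\<lambda>t. a t powr (1 / t) / real n) \<longlongrightarrow> 1) at_top"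
    by (rule tendsto_sandwich[OF _ _ c1[of c] c1[of s]])
      (use eventually_mono[OF gt a2(2)] eventually_mono[OF gt a2(1)] in auto)
  from tendsto_mult_right[OF this, of "real n"]
  have c2: "((\<lambda>t. a t powr (1 / t)) \<longlongrightarrow> real n) at_top" using n0 by simp

  have "((\<lambda>t. F t / q powr t) \<longlongrightarrow> c) at_top"
    using tendsto_divide[OF sum_powr_over_max_tendsto[OF f fin(3) q(1)] tendsto_const[of cG]] cG
    by (simp add: F_eq c_def cC0_def C0_eq mult.commute)
  from tendsto_divide[OF tendsto_const[of c] this]
  have d: "((\<lambda>t. q powr t / (F t / c)) \<longlongrightarrow> 1) at_top"
    using pos by (simp add: mult.commute)

  show ?thesis
    unfolding \<kappa>_def[symmetric] s_def[symmetric] c_def[symmetric] q_def[symmetric]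
      F_def[symmetric]
    using a1 a2 b[OF pos(2)] b[OF pos(3)] c1 c2 d by blast
qed

end
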